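(* Let $0<\beta\le 1/4$ be fixed. Suppose there is a constant $c>0$ such that for every $n$ and every set of $n$ segments in the plane, the disjointness graph $G$ of these segments satisfies $\max(\alpha(G),\omega(G))\ge c n^\beta$. Then for every $d>2$ there is a constant $c_d>0$ such that for every $n$ and every set of $n$ segments in $\mathbb{R}^d$, the disjointness graph $G$ of these segments satisfies $\max(\alpha(G),\omega(G))\ge c_d n^\beta$.
   Context: The disjointness graph of a family of sets is the graph whose vertices are the members, two adjacent iff the corresponding sets are disjoint. $\alpha(G)$ is the independence number and $\omega(G)$ the clique number of $G$. *)

theory Defs
  imports "HOL-Analysis.Analysis" "HOL-Library.Ramsey"
begin

definition is_segment :: "'a::real_vector set \<Rightarrow> bool"
  where "is_segment S \<longleftrightarrow> (\<exists>a b. a \<noteq> b \<and> S = closed_segment a b)"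

text \<open>Graphs are given by a vertex set and a set of two-element edges, the
  representation used by \<^const>\<open>clique\<close> and \<^const>\<open>indep\<close>. The vertex set of the
  disjointness graph of \<open>F\<close> is \<open>F\<close> itself, so each vertex is a set of points.\<close>

definition disjointness_edges :: "'a set set \<Rightarrow> 'a set set set"
  where "disjointness_edges F = {{S, T} | S T. S \<in> F \<and> T \<in> F \<and> S \<noteq> T \<and> S \<inter> T = {}}"

text \<open>The two maxima below are meaningful for finite \<open>V\<close> only.\<close>

definition independence_number :: "'v set \<Rightarrow> 'v set set \<Rightarrow> nat"
  where "independence_number V E = Max {card U | U. U \<subseteq> V \<and> indep U E}"

definition clique_number :: "'v set \<Rightarrow> 'v set set \<Rightarrow> nat"
  where "clique_number V E = Max {card U | U. U \<subseteq> V \<and> clique U E}"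

end

theory Submission
  imports Defs
begin

text \<open>Let \<open>k\<close> be the larger of the two numbers for a family \<open>F\<close> of segments. Fix a maximal clique,
  and for each of its members \<open>S\<close> a maximal clique among the segments that meet \<open>S\<close> and are not
  collinear with it. A segment meeting \<open>S\<close> and a member \<open>T\<close> of the latter clique either passes
  through the point \<open>S \<inter> T\<close> or lies in the plane of \<open>S\<close> and \<open>T\<close>. As at most \<open>k\<close> segments share a
  point, all but \<open>k\<^sup>3\<close> segments lie in at most \<open>k + k\<^sup>2\<close> planes.

  Now treat the planes one after the other, choosing in each a maximum clique disjoint from the
  segments chosen before. A previously chosen segment is not contained in the current plane, so it
  meets it in at most one point, and only \<open>k\<^sup>2\<close> segments per plane have to be discarded to
  guarantee this disjointness. The chosen segments form a single clique, so the clique numbers of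
  what remains in the planes add up to at most \<open>k\<close>. Moved into one common plane, far apart from
  each other, these remainders form a planar family with both numbers at most \<open>k\<close>, to which the
  hypothesis applies. Altogether \<open>n \<le> 3 k\<^sup>4 + (k / c)\<^bsup>1/\<beta>\<^esup> = O(k\<^bsup>1/\<beta>\<^esup>)\<close>, since \<open>\<beta> \<le> 1/4\<close>.\<close>

section \<open>Cliques and independent sets of disjointness graphs\<close>

text \<open>Intersecting and disjoint subfamilies get separate bounds because these behave
  differently under unions. Pairwise conditions replace the edge set, which changes with the
  family.\<close>

definition homogeneous_bound :: "nat \<Rightarrow> nat \<Rightarrow> 'a set set \<Rightarrow> bool"
  where "homogeneous_bound a w F \<longleftrightarrow>
    (\<forall>U\<subseteq>F. (pairwise (\<lambda>S T. \<not> disjnt S T) U \<longrightarrow> card U \<le> a) \<and> (pairwise disjnt U \<longrightarrow> card U \<le> w))"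

lemma homogeneous_boundD:
  assumes "homogeneous_bound a w F" "U \<subseteq> F"
  shows "pairwise (\<lambda>S T. \<not> disjnt S T) U \<Longrightarrow> card U \<le> a"
    and "pairwise disjnt U \<Longrightarrow> card U \<le> w"
  using assms by (auto simp: homogeneous_bound_def)

lemma homogeneous_bound_subset:
  "homogeneous_bound a w F \<Longrightarrow> G \<subseteq> F \<Longrightarrow> homogeneous_bound a w G"
  unfolding homogeneous_bound_def by blast

text \<open>Sets through a common point are pairwise non-adjacent.\<close>

lemma card_common_point_le:
  assumes "homogeneous_bound a w F"
  shows "card {T\<in>F. x \<in> T} \<le> a"
  by (rule homogeneous_boundD(1)[OF assms]) (auto simp: pairwise_def disjnt_iff)

lemma insert_disjointness_edges_iff:
  "{S, T} \<in> disjointness_edges F \<longleftrightarrow> S \<in> F \<and> T \<in> F \<and> S \<noteq> T \<and> disjnt S T"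
  by (auto simp: disjointness_edges_def doubleton_eq_iff disjnt_def)

lemma clique_disjointness_edges_iff:
  "U \<subseteq> F \<Longrightarrow> clique U (disjointness_edges F) \<longleftrightarrow> pairwise disjnt U"
  by (auto simp: clique_def insert_disjointness_edges_iff pairwise_def)

lemma indep_disjointness_edges_iff:
  "U \<subseteq> F \<Longrightarrow> indep U (disjointness_edges F) \<longleftrightarrow> pairwise (\<lambda>S T. \<not> disjnt S T) U"
  by (auto simp: indep_def insert_disjointness_edges_iff pairwise_def)

lemma homogeneous_bound_iff:
  assumes "finite F"
  shows "homogeneous_bound a w F \<longleftrightarrow>
    independence_number F (disjointness_edges F) \<le> a \<and> clique_number F (disjointness_edges F) \<le> w"
proof -
  have fin: "finite {card U |U. U \<subseteq> F \<and> P U}" for P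
    using assms by simp
  have ne: "{card U |U. U \<subseteq> F \<and> indep U (disjointness_edges F)} \<noteq> {}"
    "{card U |U. U \<subseteq> F \<and> clique U (disjointness_edges F)} \<noteq> {}"
    by (auto intro!: exI[of _ "{}"])
  show ?thesis
    unfolding independence_number_def clique_number_def Max_le_iff[OF fin ne(1)] Max_le_iff[OF fin ne(2)]
      homogeneous_bound_def
    using clique_disjointness_edges_iff[of _ F] indep_disjointness_edges_iff[of _ F] by blast
qed

text \<open>Each member of \<open>F\<close> is disjoint from each member of \<open>G\<close>. A
  clique splits into a part on each side, so the clique bounds add; an independent set lies on one
  side, so \<open>a\<close> stays.\<close>

lemma homogeneous_bound_Un:
  assumes F: "homogeneous_bound a w F" and G: "homogeneous_bound a v G"
    and fin: "finite F" "finite G"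
    and disj: "\<And>S T. S \<in> F \<Longrightarrow> T \<in> G \<Longrightarrow> disjnt S T"
  shows "homogeneous_bound a (w + v) (F \<union> G)"
  unfolding homogeneous_bound_def
proof (intro allI impI conjI)
  fix U assume U: "U \<subseteq> F \<union> G"
  have *: "U = (U \<inter> F) \<union> (U \<inter> G)" using U by blast
  {
    assume "pairwise disjnt U"
    then have "pairwise disjnt (U \<inter> F)" "pairwise disjnt (U \<inter> G)"
      by (auto simp: pairwise_def)
    then have "card (U \<inter> F) \<le> w" "card (U \<inter> G) \<le> v"
      using homogeneous_boundD(2)[OF F] homogeneous_boundD(2)[OF G] by auto
    moreover have "card U \<le> card (U \<inter> F) + card (U \<inter> G)"
      by (subst *) (rule card_Un_le)
    ultimately show "card U \<le> w + v" by linarith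
  }
  assume P: "pairwise (\<lambda>S T. \<not> disjnt S T) U"
  have "U \<subseteq> F \<or> U \<subseteq> G"
  proof (rule ccontr)
    assume "\<not> (U \<subseteq> F \<or> U \<subseteq> G)"
    then obtain S T where "S \<in> U" "S \<notin> F" "T \<in> U" "T \<notin> G" by blast
    then have "S \<in> G" "T \<in> F" using U by auto
    then show False
      using P disj \<open>S \<in> U\<close> \<open>T \<in> U\<close> \<open>S \<notin> F\<close> by (metis pairwise_def)
  qed
  then show "card U \<le> a"
    using homogeneous_boundD(1)[OF F _ P] homogeneous_boundD(1)[OF G _ P] by blast
qed

text \<open>Injectivity on the whole union preserves distinctness and disjointness of members, so
  the two disjointness graphs are isomorphic.\<close>

lemma homogeneous_bound_image:
  assumes F: "homogeneous_bound a w F" and inj: "inj_on f (\<Union>F)"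
  shows "homogeneous_bound a w ((`) f ` F)"
  unfolding homogeneous_bound_def
proof (intro allI impI conjI)
  fix U assume "U \<subseteq> (`) f ` F"
  then obtain V where V: "V \<subseteq> F" "U = (`) f ` V"
    by (auto simp: subset_image_iff)
  have injV: "inj_on ((`) f) V"
    using inj_on_image[OF inj] V(1) inj_on_subset by blast
  then have card: "card U = card V"
    using V(2) card_image by blast
  have dis: "disjnt (f ` S) (f ` T) \<longleftrightarrow> disjnt S T" if "S \<in> V" "T \<in> V" for S T
  proof -
    have "f ` (S \<inter> T) = f ` S \<inter> f ` T"
      using that V(1) by (intro inj_on_image_Int[OF inj]) auto
    then show ?thesis by (metis disjnt_def image_is_empty)
  qed
  have eq: "f ` S = f ` T \<longleftrightarrow> S = T" if "S \<in> V" "T \<in> V" for S T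
    using injV that by (meson inj_on_def)
  have *: "pairwise R V" if "pairwise R' U" "\<And>S T. S \<in> V \<Longrightarrow> T \<in> V \<Longrightarrow> R' (f ` S) (f ` T) \<Longrightarrow> R S T" for R R'
    using that eq by (auto simp: V(2) pairwise_def)
  show "card U \<le> a" if "pairwise (\<lambda>S T. \<not> disjnt S T) U"
    unfolding card using dis by (intro homogeneous_boundD(1)[OF F V(1)] *[OF that]) auto
  show "card U \<le> w" if "pairwise disjnt U"
    unfolding card using dis by (intro homogeneous_boundD(2)[OF F V(1)] *[OF that]) auto
qed

text \<open>By maximality, a member disjoint from all of \<open>D\<close> would already belong to
  \<open>D\<close>, hence be disjoint from itself and empty.\<close>

lemma maximal_disjoint_subfamily:
  assumes "finite F" and ne: "{} \<notin> F"
  obtains D where "D \<subseteq> F" "pairwise disjnt D" "\<And>T. T \<in> F \<Longrightarrow> \<exists>S\<in>D. \<not> disjnt S T"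
proof -
  let ?A = "{D. D \<subseteq> F \<and> pairwise disjnt D}"
  have "finite ?A" "?A \<noteq> {}"
    using assms by (auto intro!: exI[of _ "{}"])
  then obtain D where D: "D \<in> ?A" and max: "\<And>B. B \<in> ?A \<Longrightarrow> D \<subseteq> B \<Longrightarrow> D = B"
    using finite_has_maximal[of ?A] by metis
  show thesis
  proof (rule that[of D])
    show "\<exists>S\<in>D. \<not> disjnt S T" if T: "T \<in> F" for T
    proof (rule ccontr)
      assume *: "\<not> (\<exists>S\<in>D. \<not> disjnt S T)"
      then have "insert T D \<in> ?A"
        using D T by (auto simp: pairwise_insert disjnt_sym)
      then have "T \<in> D" using max by blast
      then have "disjnt T T" using * by blast
      then show False using ne T by (simp add: disjnt_def)
    qed
  qed (use D in auto)
qed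

text \<open>Taking as bound the clique number itself, attained by \<open>D\<close>, lets a sum of
  clique bounds be read as the size of an actual clique.\<close>

lemma maximum_disjoint_subfamily:
  assumes "finite F" "homogeneous_bound a w F"
  obtains D where "D \<subseteq> F" "pairwise disjnt D" "homogeneous_bound a (card D) F"
proof -
  let ?P = "\<lambda>n. \<exists>D\<subseteq>F. pairwise disjnt D \<and> card D = n"
  have "?P 0" by (intro exI[of _ "{}"]) auto
  moreover have "\<forall>n. ?P n \<longrightarrow> n \<le> w" using homogeneous_boundD(2)[OF assms(2)] by blast
  ultimately obtain n where n: "?P n" "\<forall>m. ?P m \<longrightarrow> m \<le> n"
    using Nat.ex_has_greatest_nat[of ?P 0 w] by blast
  then obtain D where D: "D \<subseteq> F" "pairwise disjnt D" "card D = n" by blast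
  have "homogeneous_bound a (card D) F"
    using assms(2) n(2) D(3) unfolding homogeneous_bound_def by blast
  with D that show thesis by blast
qed

section \<open>Segments and affine subspaces\<close>

lemma is_segment_nonempty: "is_segment S \<Longrightarrow> S \<noteq> {}"
  by (auto simp: is_segment_def)

lemma is_segment_linear_image:
  assumes "is_segment S" "linear f" "inj_on f S"
  shows "is_segment (f ` S)"
proof -
  obtain a b where ab: "a \<noteq> b" "S = closed_segment a b"
    using assms(1) by (auto simp: is_segment_def)
  then have "f a \<noteq> f b" using assms(3) by (auto simp: inj_on_def)
  then show ?thesis
    using closed_segment_linear_image[OF assms(2)] ab by (metis is_segment_def)
qed

lemma is_segment_translation: "is_segment S \<Longrightarrow> is_segment ((+) v ` S)"
  unfolding is_segment_def using closed_segment_translation[of v] by (metis add_left_cancel)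

lemma aff_dim_segment:
  fixes S :: "'a::euclidean_space set"
  shows "is_segment S \<Longrightarrow> aff_dim S = 1"
  by (auto simp: is_segment_def segment_convex_hull aff_dim_convex_hull)

text \<open>Two distinct points of a segment span its line.\<close>

lemma segment_subset_affine:
  fixes S :: "'a::euclidean_space set"
  assumes S: "is_segment S" and A: "affine A" and xy: "x \<in> S \<inter> A" "y \<in> S \<inter> A" "x \<noteq> y"
  shows "S \<subseteq> A"
proof -
  have "affine hull {x, y} = affine hull S"
    using xy aff_dim_segment[OF S] aff_dim_eq_full_gen[of "{x, y}" S] by auto
  moreover have "affine hull {x, y} \<subseteq> A"
    using xy A by (intro hull_minimal) auto
  ultimately show ?thesis using hull_subset[of S affine] by order
qed

section \<open>Realisation in the plane\<close>

definition flat2 :: "'a::euclidean_space set \<Rightarrow> bool"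
  where \<comment> \<open>Lines are included, so that segments collinear with a given one need no special treatment.\<close>
    "flat2 P \<longleftrightarrow> affine P \<and> aff_dim P \<le> 2"

text \<open>Only the size and the two bounds of the family are kept, as the hypothesis on the plane
  sees nothing else; pieces may thus be moved freely.\<close>

definition planar_realisable :: "nat \<Rightarrow> nat \<Rightarrow> nat \<Rightarrow> bool"
  where "planar_realisable n a w \<longleftrightarrow> (\<exists>G :: (real^2) set set.
    finite G \<and> card G = n \<and> (\<forall>S\<in>G. is_segment S) \<and> homogeneous_bound a w G)"

lemma planar_realisable_0: "planar_realisable 0 a w"
  unfolding planar_realisable_def by (intro exI[of _ "{}"]) (auto simp: homogeneous_bound_def)

lemma planar_realisable_add:
  assumes "planar_realisable m a w" "planar_realisable n a v"
  shows "planar_realisable (m + n) a (w + v)"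
proof -
  obtain F :: "(real^2) set set" where F: "finite F" "card F = m" "\<forall>S\<in>F. is_segment S" "homogeneous_bound a w F"
    using assms(1) by (auto simp: planar_realisable_def)
  obtain G :: "(real^2) set set" where G: "finite G" "card G = n" "\<forall>S\<in>G. is_segment S" "homogeneous_bound a v G"
    using assms(2) by (auto simp: planar_realisable_def)
  have bdd: "bounded (\<Union>H)" if "finite H" "\<forall>S\<in>H. is_segment S" for H :: "(real^2) set set"
    using that by (intro bounded_Union) (auto simp: is_segment_def bounded_closed_segment)
  obtain B where B: "\<forall>x\<in>\<Union>F. norm x \<le> B" using bdd[OF F(1,3)] bounded_iff by blast
  obtain C where C: "\<forall>x\<in>\<Union>G. norm x \<le> C" using bdd[OF G(1,3)] bounded_iff by blast
  \<comment> \<open>By the triangle inequality, this translation takes no point of norm at most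
    \<open>C\<close> to a point of norm at most \<open>B\<close>. Absolute values are taken because
    the bounds of an empty family may be negative.\<close>
  obtain v0 :: "real^2" where v0: "norm v0 = \<bar>B\<bar> + \<bar>C\<bar> + 1"
    using vector_choose_size[of "\<bar>B\<bar> + \<bar>C\<bar> + 1"] by auto
  let ?G = "(`) ((+) v0) ` G"
  have inj: "inj_on ((+) v0) (\<Union>G)" by simp
  have dis: "disjnt S T" if "S \<in> F" "T \<in> ?G" for S T
  proof (rule ccontr)
    assume "\<not> disjnt S T"
    then obtain z where "z \<in> S" "z \<in> T" by (auto simp: disjnt_iff)
    with that obtain y where y: "v0 + y \<in> S" "y \<in> \<Union>G" by auto
    then have "norm (v0 + y) \<le> B" "norm y \<le> C"
      using B C that by auto
    moreover have "norm v0 \<le> norm (v0 + y) + norm y"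
      by (metis add_diff_cancel norm_triangle_ineq4)
    ultimately show False using v0 by linarith
  qed
  have seg: "\<forall>S\<in>?G. is_segment S"
    using G(3) is_segment_translation by blast
  have "F \<inter> ?G = {}"
  proof (rule ccontr)
    assume "F \<inter> ?G \<noteq> {}"
    then obtain S where "S \<in> F" "S \<in> ?G" by blast
    then show False using dis[of S S] F(3) is_segment_nonempty by (metis disjnt_self_iff_empty)
  qed
  then have "card (F \<union> ?G) = m + n"
    using F G card_image[OF inj_on_image[OF inj]] by (subst card_Un_disjoint) auto
  moreover have "homogeneous_bound a (w + v) (F \<union> ?G)"
    using F(1) G(1) dis homogeneous_bound_Un[OF F(4) homogeneous_bound_image[OF G(4) inj]] by blast
  ultimately show ?thesis
    unfolding planar_realisable_def using F(1,3) G(1) seg by (intro exI[of _ "F \<union> ?G"]) auto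
qed

text \<open>The differences \<open>x - p\<close> form a subspace of dimension at most 2, on which
  some linear map to the plane preserves norms. All differences of points of \<open>P\<close> lie in
  that subspace, so the map is injective on \<open>P\<close>.\<close>

lemma flat2_embedding:
  fixes P :: "'a::euclidean_space set"
  assumes "flat2 P"
  obtains f :: "'a \<Rightarrow> real^2" where "linear f" "inj_on f P"
proof (cases "P = {}")
  case True
  then show thesis using that[of "\<lambda>_. 0"] by (simp add: linear_zero)
next
  case False
  then obtain p where p: "p \<in> P" by blast
  let ?S = "(\<lambda>x. x - p) ` P"
  have S: "subspace ?S" using affine_diffs_subspace_subtract p assms by (auto simp: flat2_def)
  have "int (dim ?S) \<le> 2"
    using aff_dim_dim_affine_diffs[of P p] p assms by (simp add: flat2_def)
  then have "dim ?S \<le> dim (UNIV :: (real^2) set)" by simp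
  from isometry_subset_subspace[OF S subspace_UNIV this]
  obtain f :: "'a \<Rightarrow> real^2" where f: "linear f" "\<And>x. x \<in> ?S \<Longrightarrow> norm (f x) = norm x"
    by metis
  have "inj_on f P"
  proof (rule inj_onI)
    fix x y assume xy: "x \<in> P" "y \<in> P" "f x = f y"
    have "(x - p) - (y - p) \<in> ?S" using xy by (intro subspace_diff[OF S, of "x - p" "y - p"] imageI)
    moreover have "(x - p) - (y - p) = x - y" by simp
    ultimately have "x - y \<in> ?S" by (simp only:)
    then have "norm (f (x - y)) = norm (x - y)" by (rule f(2))
    then show "x = y" using xy linear_diff[OF f(1)] by simp
  qed
  with f that show thesis by blast
qed

lemma planar_realisable_flat2:
  fixes F :: "'a::euclidean_space set set"
  assumes "finite F" "\<forall>S\<in>F. is_segment S" "homogeneous_bound a w F" "flat2 P" "\<Union>F \<subseteq> P"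
  shows "planar_realisable (card F) a w"
proof -
  obtain f :: "'a \<Rightarrow> real^2" where f: "linear f" "inj_on f P"
    using flat2_embedding assms(4) by blast
  then have inj: "inj_on f (\<Union>F)" using assms(5) inj_on_subset by blast
  have "is_segment (f ` S)" if "S \<in> F" for S
    using that assms(2) f(1) inj by (intro is_segment_linear_image) (auto intro: inj_on_subset)
  then show ?thesis
    unfolding planar_realisable_def
    using assms(1) homogeneous_bound_image[OF assms(3) inj] card_image[OF inj_on_image[OF inj]]
    by (intro exI[of _ "(`) f ` F"]) auto
qed

section \<open>Covering most segments by few flats\<close>

lemma card_UN_le_mult:
  assumes "finite I" "card I \<le> m" "\<And>i. i \<in> I \<Longrightarrow> card (A i) \<le> n"
  shows "card (\<Union>i\<in>I. A i) \<le> m * n"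
proof -
  have "card (\<Union>i\<in>I. A i) \<le> (\<Sum>i\<in>I. card (A i))" by (rule card_UN_le[OF assms(1)])
  also have "\<dots> \<le> card I * n" using sum_bounded_above[of I "\<lambda>i. card (A i)" n] assms(3) by simp
  also have "\<dots> \<le> m * n" using assms(2) by simp
  finally show ?thesis .
qed

lemma flat2_cover:
  fixes F :: "'a::euclidean_space set set"
  assumes fin: "finite F" and seg: "\<forall>S\<in>F. is_segment S" and hom: "homogeneous_bound k k F"
  obtains R \<P> where "R \<subseteq> F" "card R \<le> k * k * k" "finite \<P>" "card \<P> \<le> k + k * k"
    "\<forall>P\<in>\<P>. flat2 P" "\<forall>T\<in>F - R. \<exists>P\<in>\<P>. T \<subseteq> P"
proof -
  have ne: "{} \<notin> F" using seg is_segment_nonempty by blast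
  obtain C where C: "C \<subseteq> F" "pairwise disjnt C" and Cmax: "\<And>T. T \<in> F \<Longrightarrow> \<exists>S\<in>C. \<not> disjnt S T"
    using maximal_disjoint_subfamily[OF fin ne] by metis
  \<comment> \<open>Segments on the line of \<open>S\<close> are excluded: that line is itself one
    of the flats, and the remaining segments meet \<open>S\<close> in exactly one point.\<close>
  define N where "N S = {T\<in>F. \<not> disjnt S T \<and> \<not> T \<subseteq> affine hull S}" for S
  have "\<exists>D\<subseteq>N S. pairwise disjnt D \<and> (\<forall>T\<in>N S. \<exists>S\<in>D. \<not> disjnt S T)" for S
  proof -
    have "finite (N S)" "{} \<notin> N S" using fin ne by (auto simp: N_def)
    then obtain D where "D \<subseteq> N S" "pairwise disjnt D" "\<And>T. T \<in> N S \<Longrightarrow> \<exists>S\<in>D. \<not> disjnt S T"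
      using maximal_disjoint_subfamily by metis
    then show ?thesis by blast
  qed
  then obtain M where M: "\<And>S. M S \<subseteq> N S" "\<And>S. pairwise disjnt (M S)"
    and Mmax: "\<And>S T. T \<in> N S \<Longrightarrow> \<exists>U\<in>M S. \<not> disjnt U T"
    by metis
  \<comment> \<open>A point of \<open>T\<close> off the line of \<open>S\<close>; together with
    \<open>S\<close> it spans the plane of \<open>S\<close> and \<open>T\<close>.\<close>
  define q where "q S T = (SOME x. x \<in> T - affine hull S)" for S T :: "'a set"
  have q: "q S T \<in> T - affine hull S" if "T \<in> N S" for S T
    unfolding q_def using that by (intro someI_ex[of "\<lambda>x. x \<in> T - affine hull S"]) (auto simp: N_def)
  have finC: "finite C" and cardC: "card C \<le> k"
    using finite_subset[OF C(1) fin] homogeneous_boundD(2)[OF hom C] by auto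
  have MF: "M S \<subseteq> F" for S using M(1) by (auto simp: N_def)
  have finM: "finite (M S)" and cardM: "card (M S) \<le> k" for S
    using finite_subset[OF MF fin] homogeneous_boundD(2)[OF hom MF M(2)] by auto
  define I where "I = Sigma C M"
  have finI: "finite I" using finC finM by (auto simp: I_def)
  have "card I = (\<Sum>S\<in>C. card (M S))"
    unfolding I_def using finC finM by (intro card_SigmaI) auto
  also have "\<dots> \<le> card C * k" using sum_bounded_above[of C "\<lambda>S. card (M S)" k] cardM by simp
  also have "\<dots> \<le> k * k" using cardC by simp
  finally have cardI: "card I \<le> k * k" .
  define flat where "flat = (\<lambda>(S, T). affine hull (insert (q S T) S))"
  define \<P> where "\<P> = (hull) affine ` C \<union> flat ` I"
  \<comment> \<open>For each of the at most \<open>k * k\<close> pairs, \<open>S \<inter> T\<close>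
    is a single point, so at most \<open>k\<close> segments pass through it.\<close>
  define R where "R = (\<Union>(S, T)\<in>I. {U\<in>F. U \<inter> (S \<inter> T) \<noteq> {}})"
  have single: "\<exists>p. S \<inter> T = {p}" if "S \<in> C" "T \<in> M S" for S T
  proof -
    have T: "T \<in> N S" using that M(1) by blast
    then have "S \<inter> T \<noteq> {}" by (auto simp: N_def disjnt_def)
    moreover have "x = y" if xy: "x \<in> S \<inter> T" "y \<in> S \<inter> T" for x y
    proof (rule ccontr)
      assume "x \<noteq> y"
      then have "T \<subseteq> affine hull S"
        using xy T seg hull_subset[of S affine]
        by (intro segment_subset_affine[of T _ x y]) (auto simp: N_def)
      with T show False by (auto simp: N_def)
    qed
    ultimately show ?thesis by blast
  qed
  show thesis
  proof (rule that[of R \<P>])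
    show "R \<subseteq> F" by (auto simp: R_def)
    have "card (case i of (S, T) \<Rightarrow> {U\<in>F. U \<inter> (S \<inter> T) \<noteq> {}}) \<le> k" if "i \<in> I" for i
    proof -
      from that obtain S T where i: "i = (S, T)" "S \<in> C" "T \<in> M S" by (auto simp: I_def)
      then obtain p where "S \<inter> T = {p}" using single by blast
      then show ?thesis using card_common_point_le[OF hom, of p] i(1) by auto
    qed
    then show "card R \<le> k * k * k"
      unfolding R_def by (intro card_UN_le_mult finI cardI)
    show "finite \<P>" using finC finI by (simp add: \<P>_def)
    have "card \<P> \<le> card ((hull) affine ` C) + card (flat ` I)"
      unfolding \<P>_def by (rule card_Un_le)
    also have "\<dots> \<le> card C + card I"
      by (intro add_mono card_image_le finC finI)
    finally show "card \<P> \<le> k + k * k" using cardC cardI by linarith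
    show "\<forall>P\<in>\<P>. flat2 P"
    proof
      fix P assume "P \<in> \<P>"
      then consider S where "S \<in> C" "P = affine hull S"
        | S T where "S \<in> C" "P = affine hull (insert (q S T) S)"
        by (auto simp: \<P>_def I_def flat_def)
      then show "flat2 P"
      proof cases
        case 1
        then have "aff_dim S = 1" using C(1) seg by (intro aff_dim_segment) auto
        with 1 show ?thesis by (simp add: flat2_def)
      next
        case 2
        then have "aff_dim S = 1" using C(1) seg by (intro aff_dim_segment) auto
        with 2 show ?thesis by (simp add: flat2_def aff_dim_insert)
      qed
    qed
    show "\<forall>U\<in>F - R. \<exists>P\<in>\<P>. U \<subseteq> P"
    proof
      fix U assume U: "U \<in> F - R"
      then obtain S where S: "S \<in> C" "\<not> disjnt S U" using Cmax by blast
      show "\<exists>P\<in>\<P>. U \<subseteq> P"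
      proof (cases "U \<subseteq> affine hull S")
        case True
        then show ?thesis using S by (auto simp: \<P>_def)
      next
        case False
        then have "U \<in> N S" using U S by (auto simp: N_def)
        then obtain T where T: "T \<in> M S" "\<not> disjnt T U" using Mmax by blast
        then have TN: "T \<in> N S" using M(1) by blast
        have ST: "(S, T) \<in> I" using S T by (auto simp: I_def)
        obtain x y where x: "x \<in> S" "x \<in> U" and y: "y \<in> T" "y \<in> U"
          using S(2) T(2) by (auto simp: disjnt_iff)
        \<comment> \<open>Outside \<open>R\<close>, the segment \<open>U\<close> misses the common
          point of \<open>S\<close> and \<open>T\<close>, so it meets them in different points, both
          in the plane of \<open>S\<close> and \<open>T\<close>.\<close>
        have "U \<inter> (S \<inter> T) = {}" using U ST by (auto simp: R_def)
        then have "x \<noteq> y" using x y by blast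
        have sub: "insert (q S T) S \<subseteq> flat (S, T)"
          unfolding flat_def by (simp add: hull_subset)
        obtain p where p: "p \<in> S" "p \<in> T" using TN by (auto simp: N_def disjnt_iff)
        \<comment> \<open>\<open>p\<close> is on the line of \<open>S\<close> and
          \<open>q S T\<close> is not, so \<open>T\<close> has two distinct points in the
          flat.\<close>
        have "q S T \<noteq> p" using q[OF TN] p hull_subset[of S affine] by blast
        moreover have "affine (flat (S, T))" by (simp add: flat_def)
        moreover have "is_segment T" using TN seg by (auto simp: N_def)
        ultimately have "T \<subseteq> flat (S, T)"
          using p q[OF TN] sub by (intro segment_subset_affine[of T _ p "q S T"]) auto
        then have "U \<subseteq> flat (S, T)"
          using x y \<open>x \<noteq> y\<close> U seg sub \<open>affine (flat (S, T))\<close>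
          by (intro segment_subset_affine[of U _ x y]) auto
        then show ?thesis using ST by (auto simp: \<P>_def)
      qed
    qed
  qed
qed

section \<open>Disjoint cliques chosen flat by flat\<close>

text \<open>The realised clique bound is tied to a clique \<open>D\<close> of \<open>F\<close>
  itself. This invariant keeps it at most \<open>k\<close>, whatever the number of flats.\<close>

lemma flat2_cover_realisable:
  fixes F :: "'a::euclidean_space set set"
  assumes "finite \<P>" "\<forall>P\<in>\<P>. flat2 P" "finite F" "\<forall>S\<in>F. is_segment S" "homogeneous_bound k k F"
    and "\<forall>T\<in>F. \<exists>P\<in>\<P>. T \<subseteq> P"
  shows "\<exists>R D. R \<subseteq> F \<and> D \<subseteq> F \<and> pairwise disjnt D \<and> card R \<le> card \<P> * (k * k) \<and>
    planar_realisable (card (F - R)) k (card D)"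
  using assms
proof (induction \<P> arbitrary: F rule: finite_induct)
  case empty
  then have "F = {}" by blast
  then show ?case using planar_realisable_0 by auto
next
  case (insert P \<P>)
  define F0 where "F0 = {T\<in>F. T \<subseteq> P}"
  define F1 where "F1 = F - F0"
  \<comment> \<open>\<open>P\<close> is processed after the other flats; as \<open>F0\<close> takes every segment inside \<open>P\<close>, those chosen
    for the other flats meet \<open>P\<close> in at most a point.\<close>
  have F1F: "F1 \<subseteq> F" and F0F: "F0 \<subseteq> F" by (auto simp: F0_def F1_def)
  note fin = \<open>finite F\<close> and seg = \<open>\<forall>S\<in>F. is_segment S\<close> and hom = \<open>homogeneous_bound k k F\<close>
  have "\<exists>R D. R \<subseteq> F1 \<and> D \<subseteq> F1 \<and> pairwise disjnt D \<and> card R \<le> card \<P> * (k * k) \<and>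
    planar_realisable (card (F1 - R)) k (card D)"
  proof (rule insert.IH)
    show "\<forall>T\<in>F1. \<exists>P\<in>\<P>. T \<subseteq> P" using insert.prems(5) by (auto simp: F1_def F0_def)
    show "homogeneous_bound k k F1" using hom F1F homogeneous_bound_subset by blast
  qed (use insert.prems F1F in \<open>auto intro: finite_subset\<close>)
  then obtain R1 D1 where R1: "R1 \<subseteq> F1" "card R1 \<le> card \<P> * (k * k)"
    and D1: "D1 \<subseteq> F1" "pairwise disjnt D1"
    and real1: "planar_realisable (card (F1 - R1)) k (card D1)"
    by blast
  have finD1: "finite D1" by (rule finite_subset[OF D1(1) finite_subset[OF F1F fin]])
  have cardD1: "card D1 \<le> k" by (rule homogeneous_boundD(2)[OF hom subset_trans[OF D1(1) F1F] D1(2)])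
  \<comment> \<open>Discarding these segments makes every clique in the rest of \<open>F0\<close>
    disjoint from \<open>D1\<close>.\<close>
  define R0 where "R0 = (\<Union>S\<in>D1. {T\<in>F0. \<not> disjnt S T})"
  have "affine P" using insert.prems(1) by (simp add: flat2_def)
  have "card {T\<in>F0. \<not> disjnt S T} \<le> k" if S: "S \<in> D1" for S
  proof -
    have S': "S \<in> F" "\<not> S \<subseteq> P" using S D1(1) by (auto simp: F1_def F0_def)
    show ?thesis
    proof (cases "S \<inter> P = {}")
      case True
      then have "{T\<in>F0. \<not> disjnt S T} = {}" by (auto simp: F0_def disjnt_iff)
      then show ?thesis by (metis card.empty le0)
    next
      case False
      then obtain x where x: "x \<in> S \<inter> P" by blast
      then have "y = x" if "y \<in> S \<inter> P" for y
        using segment_subset_affine[of S P x y] S' seg \<open>affine P\<close> that by blast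
      \<comment> \<open>Members of \<open>F0\<close> lie in \<open>P\<close>, so those meeting
        \<open>S\<close> all pass through \<open>x\<close>.\<close>
      then have "{T\<in>F0. \<not> disjnt S T} \<subseteq> {T\<in>F. x \<in> T}"
        by (auto simp: F0_def disjnt_iff)
      then have "card {T\<in>F0. \<not> disjnt S T} \<le> card {T\<in>F. x \<in> T}"
        using fin by (intro card_mono) auto
      then show ?thesis using card_common_point_le[OF hom, of x] by linarith
    qed
  qed
  then have cardR0: "card R0 \<le> k * k"
    unfolding R0_def by (rule card_UN_le_mult[OF finD1 cardD1])
  have "homogeneous_bound k k (F0 - R0)" using F0F by (intro homogeneous_bound_subset[OF hom]) auto
  moreover have fin0: "finite (F0 - R0)" using finite_subset[OF F0F fin] by simp
  \<comment> \<open>A maximum clique, so that the clique bound contributed by this flat is matched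
    by new members of the common clique.\<close>
  ultimately obtain D0 where D0: "D0 \<subseteq> F0 - R0" "pairwise disjnt D0"
    and hom0: "homogeneous_bound k (card D0) (F0 - R0)"
    using maximum_disjoint_subfamily by metis
  have "planar_realisable (card (F0 - R0)) k (card D0)"
    using seg hom0 fin0 insert.prems(1) by (intro planar_realisable_flat2[of _ _ _ P]) (auto simp: F0_def)
  then have "planar_realisable (card (F0 - R0) + card (F1 - R1)) k (card D0 + card D1)"
    using real1 by (rule planar_realisable_add)
  moreover have "card (F0 - R0) + card (F1 - R1) = card (F - (R0 \<union> R1))"
  proof -
    have "F - (R0 \<union> R1) = (F0 - R0) \<union> (F1 - R1)"
      using R1(1) by (auto simp: F1_def R0_def F0_def)
    then show ?thesis
      using fin0 finite_subset[OF F1F fin] by (subst card_Un_disjoint[symmetric]) (auto simp: F1_def)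
  qed
  moreover have "card D0 + card D1 = card (D0 \<union> D1)"
    using D0(1) D1(1) finD1 finite_subset[OF D0(1) fin0]
    by (subst card_Un_disjoint) (auto simp: F1_def)
  moreover have "pairwise disjnt (D0 \<union> D1)"
    unfolding pairwise_def
  proof (intro ballI impI)
    have *: "disjnt S T" if "S \<in> D1" "T \<in> D0" for S T
      using that D0(1) by (auto simp: R0_def)
    fix S T assume "S \<in> D0 \<union> D1" "T \<in> D0 \<union> D1" "S \<noteq> T"
    then show "disjnt S T"
      using *[of S T] *[of T S] pairwiseD[OF D0(2), of S T] pairwiseD[OF D1(2), of S T] disjnt_sym by blast
  qed
  moreover have "card (R0 \<union> R1) \<le> card (insert P \<P>) * (k * k)"
    using card_Un_le[of R0 R1] cardR0 R1(2) insert.hyps by simp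
  moreover have "R0 \<union> R1 \<subseteq> F" "D0 \<union> D1 \<subseteq> F"
    using R1(1) D1(1) D0(1) F0F F1F by (auto simp: R0_def)
  ultimately show ?case by metis
qed

section \<open>Counting and the exponent\<close>

text \<open>The two rounds discard at most \<open>k^3\<close> and \<open>(k + k^2) * k^2\<close>
  segments, in total at most \<open>3 * k^4\<close>. The remainder has clique bound
  \<open>card D\<close>, which is at most \<open>k\<close> because \<open>D\<close> is a clique of
  \<open>F\<close>.\<close>

lemma planar_realisable_of_segments:
  fixes F :: "'a::euclidean_space set set"
  assumes "finite F" "\<forall>S\<in>F. is_segment S" "homogeneous_bound k k F"
  obtains m w where "planar_realisable m k w" "w \<le> k" "card F \<le> 3 * k ^ 4 + m"
proof -
  obtain R \<P> where R: "R \<subseteq> F" "card R \<le> k * k * k"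
    and P: "finite \<P>" "card \<P> \<le> k + k * k" "\<forall>P\<in>\<P>. flat2 P" "\<forall>T\<in>F - R. \<exists>P\<in>\<P>. T \<subseteq> P"
    using flat2_cover[OF assms] by metis
  have hom: "homogeneous_bound k k (F - R)" using assms(3) homogeneous_bound_subset by blast
  have "\<exists>R' D. R' \<subseteq> F - R \<and> D \<subseteq> F - R \<and> pairwise disjnt D \<and> card R' \<le> card \<P> * (k * k) \<and>
    planar_realisable (card (F - R - R')) k (card D)"
    using assms P hom by (intro flat2_cover_realisable) auto
  then obtain R' D where R': "R' \<subseteq> F - R" "card R' \<le> card \<P> * (k * k)"
    and D: "D \<subseteq> F - R" "pairwise disjnt D"
    and real: "planar_realisable (card (F - R - R')) k (card D)" by blast
  have "card F \<le> card R + card R' + card (F - R - R')"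
  proof -
    have "F = (R \<union> R') \<union> (F - R - R')" using R(1) R'(1) by blast
    then show ?thesis
      using card_Un_le[of "R \<union> R'" "F - R - R'"] card_Un_le[of R R'] by simp
  qed
  moreover have "card R' \<le> k * k * k + k ^ 4"
  proof -
    have "card R' \<le> (k + k * k) * (k * k)"
      using R'(2) P(2) by (meson le_trans mult_le_mono1)
    then show ?thesis by (simp add: power4_eq_xxxx algebra_simps)
  qed
  moreover have "k * k * k \<le> k ^ 4"
    by (cases k) (auto simp: power4_eq_xxxx)
  ultimately have "card F \<le> 3 * k ^ 4 + card (F - R - R')"
    using R(2) by linarith
  moreover have "card D \<le> k" using homogeneous_boundD(2)[OF hom D] .
  ultimately show thesis using that real by blast
qed

theorem theorem4:
  fixes \<beta> :: real
  assumes "0 < \<beta>" and "\<beta> \<le> 1/4"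
    and "\<exists>c>0. \<forall>(n::nat) (F :: (real^2) set set).
           finite F \<and> card F = n \<and> (\<forall>S\<in>F. is_segment S) \<longrightarrow>
           real (max (independence_number F (disjointness_edges F))
                     (clique_number F (disjointness_edges F))) \<ge> c * real n powr \<beta>"
    and "CARD('d::finite) > 2"
  shows "\<exists>c\<^sub>d>0. \<forall>(n::nat) (F :: (real^'d) set set).
           finite F \<and> card F = n \<and> (\<forall>S\<in>F. is_segment S) \<longrightarrow>
           real (max (independence_number F (disjointness_edges F))
                     (clique_number F (disjointness_edges F))) \<ge> c\<^sub>d * real n powr \<beta>"
proof -
  obtain c where c: "c > 0" and plane: "\<And>F :: (real^2) set set. finite F \<Longrightarrow> \<forall>S\<in>F. is_segment S \<Longrightarrow>
      c * real (card F) powr \<beta> \<le> real (max (independence_number F (disjointness_edges F))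
                     (clique_number F (disjointness_edges F)))"
    using assms(3) by blast
  \<comment> \<open>Chosen so that \<open>3 * k^4 + (k / c) powr (1 / \<beta>)\<close> is at most
    \<open>K * k powr (1 / \<beta>)\<close>; raising to the power \<beta> then gives the constant
    \<open>K powr (- \<beta>)\<close>.\<close>
  define K where "K = 3 + (1 / c) powr (1 / \<beta>)"
  have K: "K > 0" unfolding K_def by (simp add: add_pos_nonneg)
  have main: "K powr (- \<beta>) * real (card F) powr \<beta> \<le> real (max (independence_number F (disjointness_edges F))
                     (clique_number F (disjointness_edges F)))"
    if F: "finite F" "\<forall>S\<in>F. is_segment S" for F :: "(real^'d) set set"
  proof -
    define k where "k = max (independence_number F (disjointness_edges F))
                     (clique_number F (disjointness_edges F))"
    have hom: "homogeneous_bound k k F"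
      by (simp add: homogeneous_bound_iff[OF F(1)] k_def)
    obtain m w where m: "planar_realisable m k w" "w \<le> k" "card F \<le> 3 * k ^ 4 + m"
      using planar_realisable_of_segments[OF F hom] by blast
    then obtain G :: "(real^2) set set" where G: "finite G" "card G = m" "\<forall>S\<in>G. is_segment S"
      and homG: "homogeneous_bound k w G" by (auto simp: planar_realisable_def)
    have "c * real m powr \<beta> \<le> real k"
    proof -
      have "max (independence_number G (disjointness_edges G)) (clique_number G (disjointness_edges G)) \<le> k"
        using homG m(2) by (simp add: homogeneous_bound_iff[OF G(1)])
      then show ?thesis
        using plane[OF G(1,3)] G(2) by (meson of_nat_le_iff order_trans)
    qed
    then have "real m powr \<beta> \<le> (1 / c) * real k" using c by (simp add: field_simps)
    then have "(real m powr \<beta>) powr (1 / \<beta>) \<le> ((1 / c) * real k) powr (1 / \<beta>)"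
      using assms(1) by (intro powr_mono2) auto
    then have m_le: "real m \<le> (1 / c) powr (1 / \<beta>) * real k powr (1 / \<beta>)"
      using assms(1) c by (simp only: powr_powr powr_mult) simp
    \<comment> \<open>The assumption \<beta> \<le> 1/4 enters here, as 4 \<le> 1/\<beta>.
      Monotonicity in the exponent needs a base of at least 1; for \<open>k = 0\<close> both sides
      vanish.\<close>
    have k4: "real k ^ 4 \<le> real k powr (1 / \<beta>)"
    proof (cases "k = 0")
      case False
      have "4 \<le> 1 / \<beta>" using assms(1,2) by (simp add: field_simps)
      then have "real k powr 4 \<le> real k powr (1 / \<beta>)" using False by (intro powr_mono) auto
      then show ?thesis using False by (simp add: powr_numeral)
    qed simp
    have "real (card F) \<le> 3 * real k ^ 4 + real m"
      using m(3) by (metis (mono_tags, lifting) of_nat_add of_nat_le_iff of_nat_mult of_nat_numeral of_nat_power)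
    also have "\<dots> \<le> K * real k powr (1 / \<beta>)"
      using m_le k4 by (simp add: K_def algebra_simps)
    finally have "real (card F) powr \<beta> \<le> (K * real k powr (1 / \<beta>)) powr \<beta>"
      using assms(1) by (intro powr_mono2) auto
    also have "\<dots> = K powr \<beta> * real k"
      using assms(1) K by (simp add: powr_powr powr_mult)
    finally show ?thesis
      unfolding k_def[symmetric] using K by (simp add: powr_minus field_simps)
  qed
  show ?thesis
    using main K by (intro exI[of _ "K powr (- \<beta>)"]) auto
qed

end
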